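(* Let $\Omega$ be a slice domain in $\mathbb{H}$, let $f:\Omega\to\mathbb{H}$ be a slice regular function and let $Z(f)=\{q\in\Omega: f(q)=0\}$. Either $f\equiv0$ or, for any $S=x+y\mathbb{S}$ (with $x,y\in\mathbb{R}$) intersecting $\Omega$ and for any connected component $C$ of $S\cap\Omega$, the set $Z(f)\setminus C$ has no accumulation points in $C$.
   Context: $\mathbb{H}$ is the real algebra of quaternions, $\mathbb{S}=\{J\in\mathbb{H}:J^2=-1\}$, $x+y\mathbb{S}=\{x+yJ:J\in\mathbb{S}\}$, $L_I=\mathbb{R}+I\mathbb{R}$ and $T_I=T\cap L_I$ for $I\in\mathbb{S}$, $T\subseteq\mathbb{H}$. A domain is a nonempty open connected set; a slice domain is a domain $\Omega\subseteq\mathbb{H}$ with $\Omega\cap\mathbb{R}\neq\emptyset$ such that $\Omega_I$ is a domain of $L_I$ for every $I\in\mathbb{S}$. A function $f:\Omega\to\mathbb{H}$ is slice regular if, for every $I\in\mathbb{S}$, the restriction $f_I$ of $f$ to $\Omega_I$ has continuous partial derivatives and $\frac12\left(\frac{\partial}{\partial x}+I\frac{\partial}{\partial y}\right)f_I(x+yI)\equiv0$. *)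

theory Defs
  imports "HOL-Analysis.Analysis"
begin

section \<open>The real algebra of quaternions\<close>

text \<open>
  \<open>Quat a b c d\<close> is \<open>a + b i + c j + d k\<close>. The type is equipped with its usual
  algebra structure and Euclidean norm, so that the topological notions of the library apply to it.
  The reals are embedded by \<open>of_real\<close>, with image \<open>\<real>\<close>.
\<close>

codatatype quat = Quat (Re0: real) (Im1: real) (Im2: real) (Im3: real)

lemma quat_eqI [intro?]:
  "\<lbrakk>Re0 p = Re0 q; Im1 p = Im1 q; Im2 p = Im2 q; Im3 p = Im3 q\<rbrakk> \<Longrightarrow> p = q"
  by (rule quat.expand) simp

lemma quat_eq_iff:
  "p = q \<longleftrightarrow> Re0 p = Re0 q \<and> Im1 p = Im1 q \<and> Im2 p = Im2 q \<and> Im3 p = Im3 q"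
  by (auto intro: quat.expand)

instantiation quat :: ab_group_add
begin

primcorec zero_quat where
  "Re0 0 = 0" | "Im1 0 = 0" | "Im2 0 = 0" | "Im3 0 = 0"

primcorec plus_quat where
  "Re0 (p + q) = Re0 p + Re0 q"
| "Im1 (p + q) = Im1 p + Im1 q"
| "Im2 (p + q) = Im2 p + Im2 q"
| "Im3 (p + q) = Im3 p + Im3 q"

primcorec uminus_quat where
  "Re0 (- p) = - Re0 p"
| "Im1 (- p) = - Im1 p"
| "Im2 (- p) = - Im2 p"
| "Im3 (- p) = - Im3 p"

primcorec minus_quat where
  "Re0 (p - q) = Re0 p - Re0 q"
| "Im1 (p - q) = Im1 p - Im1 q"
| "Im2 (p - q) = Im2 p - Im2 q"
| "Im3 (p - q) = Im3 p - Im3 q"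

instance
  by standard (simp_all add: quat_eq_iff)

end

instantiation quat :: real_algebra_1
begin

primcorec one_quat where
  "Re0 1 = 1" | "Im1 1 = 0" | "Im2 1 = 0" | "Im3 1 = 0"

primcorec times_quat where
  "Re0 (p * q) = Re0 p * Re0 q - Im1 p * Im1 q - Im2 p * Im2 q - Im3 p * Im3 q"
| "Im1 (p * q) = Re0 p * Im1 q + Im1 p * Re0 q + Im2 p * Im3 q - Im3 p * Im2 q"
| "Im2 (p * q) = Re0 p * Im2 q - Im1 p * Im3 q + Im2 p * Re0 q + Im3 p * Im1 q"
| "Im3 (p * q) = Re0 p * Im3 q + Im1 p * Im2 q - Im2 p * Im1 q + Im3 p * Re0 q"

primcorec scaleR_quat where
  "Re0 (scaleR r q) = r * Re0 q"
| "Im1 (scaleR r q) = r * Im1 q"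
| "Im2 (scaleR r q) = r * Im2 q"
| "Im3 (scaleR r q) = r * Im3 q"

instance
  by standard (simp_all add: quat_eq_iff algebra_simps)

end

instantiation quat :: real_div_algebra
begin

primcorec inverse_quat where
  "Re0 (inverse q) = Re0 q / ((Re0 q)\<^sup>2 + (Im1 q)\<^sup>2 + (Im2 q)\<^sup>2 + (Im3 q)\<^sup>2)"
| "Im1 (inverse q) = - Im1 q / ((Re0 q)\<^sup>2 + (Im1 q)\<^sup>2 + (Im2 q)\<^sup>2 + (Im3 q)\<^sup>2)"
| "Im2 (inverse q) = - Im2 q / ((Re0 q)\<^sup>2 + (Im1 q)\<^sup>2 + (Im2 q)\<^sup>2 + (Im3 q)\<^sup>2)"
| "Im3 (inverse q) = - Im3 q / ((Re0 q)\<^sup>2 + (Im1 q)\<^sup>2 + (Im2 q)\<^sup>2 + (Im3 q)\<^sup>2)"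

definition "p div q = p * inverse q" for p q :: quat

instance
proof
  fix p q :: quat
  let ?n = "(Re0 p)\<^sup>2 + (Im1 p)\<^sup>2 + (Im2 p)\<^sup>2 + (Im3 p)\<^sup>2"
  show "p div q = p * inverse q"
    by (rule divide_quat_def)
  show "inverse (0 :: quat) = 0"
    by (simp add: quat_eq_iff)
  assume "p \<noteq> 0"
  then have n: "?n \<noteq> 0"
    by (auto simp: quat_eq_iff add_nonneg_eq_0_iff)
  have norm: "Re0 p * Re0 p / ?n + Im1 p * Im1 p / ?n + Im2 p * Im2 p / ?n + Im3 p * Im3 p / ?n = 1"
    using n by (simp add: power2_eq_square flip: add_divide_distrib)
  show "inverse p * p = 1" "p * inverse p = 1"
    using norm by (simp_all add: quat_eq_iff mult.commute)
qed

end

instantiation quat :: real_normed_div_algebra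
begin

definition norm_quat_def:
  "norm q = sqrt ((Re0 q)\<^sup>2 + (Im1 q)\<^sup>2 + (Im2 q)\<^sup>2 + (Im3 q)\<^sup>2)"

definition sgn_quat_def: "sgn q = q /\<^sub>R norm q" for q :: quat

definition dist_quat_def: "dist p q = norm (p - q)" for p q :: quat

definition uniformity_quat_def [code del]:
  "(uniformity :: (quat \<times> quat) filter) = (INF e\<in>{0 <..}. principal {(x, y). dist x y < e})"

definition open_quat_def [code del]:
  "open (U :: quat set) \<longleftrightarrow> (\<forall>x\<in>U. eventually (\<lambda>(x', y). x' = x \<longrightarrow> y \<in> U) uniformity)"

lemma norm_quat_eq_norm_Pair: "norm q = norm ((Re0 q, Im1 q), (Im2 q, Im3 q))"
  by (simp add: norm_quat_def norm_Pair add.assoc)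

instance
proof
  fix r :: real and p q :: quat and U :: "quat set"
  show "norm q = 0 \<longleftrightarrow> q = 0"
    by (simp add: norm_quat_eq_norm_Pair quat_eq_iff zero_prod_def)
  show "norm (p + q) \<le> norm p + norm q"
    unfolding norm_quat_eq_norm_Pair
    using norm_triangle_ineq[of "((Re0 p, Im1 p), (Im2 p, Im3 p))" "((Re0 q, Im1 q), (Im2 q, Im3 q))"]
    by simp
  show "norm (r *\<^sub>R q) = \<bar>r\<bar> * norm q"
    unfolding norm_quat_eq_norm_Pair
    using norm_scaleR[of r "((Re0 q, Im1 q), (Im2 q, Im3 q))"] by simp
  show "norm (p * q) = norm p * norm q"
    unfolding norm_quat_def real_sqrt_mult[symmetric]
    by (simp add: power2_eq_square algebra_simps)
qed (rule sgn_quat_def dist_quat_def uniformity_quat_def open_quat_def)+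

end

instantiation quat :: real_inner
begin

definition inner_quat_def:
  "inner p q = Re0 p * Re0 q + Im1 p * Im1 q + Im2 p * Im2 q + Im3 p * Im3 q"

instance
proof
  fix r :: real and p q s :: quat
  show "inner p q = inner q p" "inner (p + q) s = inner p s + inner q s"
    "inner (r *\<^sub>R p) q = r * inner p q"
    by (simp_all add: inner_quat_def algebra_simps)
  show "0 \<le> inner p p"
    by (simp add: inner_quat_def)
  show "inner p p = 0 \<longleftrightarrow> p = 0"
    by (auto simp: inner_quat_def quat_eq_iff add_nonneg_eq_0_iff)
  show "norm p = sqrt (inner p p)"
    by (simp add: inner_quat_def norm_quat_def power2_eq_square)
qed

end

instantiation quat :: euclidean_space
begin

definition Basis_quat_def:
  "Basis = {Quat 1 0 0 0, Quat 0 1 0 0, Quat 0 0 1 0, Quat 0 0 0 1}"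

instance
proof
  fix u v x :: quat
  show "(Basis :: quat set) \<noteq> {}" "finite (Basis :: quat set)"
    by (simp_all add: Basis_quat_def)
  show "inner u v = (if u = v then 1 else 0)" if "u \<in> Basis" "v \<in> Basis"
    using that unfolding Basis_quat_def by (elim insertE emptyE) (simp_all add: inner_quat_def)
  show "(\<forall>u\<in>Basis. inner x u = 0) \<longleftrightarrow> x = 0"
    by (simp add: Basis_quat_def inner_quat_def quat_eq_iff[of x 0])
qed

end

section \<open>Slice regular functions on slice domains\<close>

definition imaginary_units :: "quat set" where
  "imaginary_units = {J. J\<^sup>2 = -1}"

definition slice_point :: "quat \<Rightarrow> real \<Rightarrow> real \<Rightarrow> quat" where
  "slice_point J x y = of_real x + of_real y * J"

definition two_sphere :: "real \<Rightarrow> real \<Rightarrow> quat set" where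
  "two_sphere x y = {slice_point J x y | J. J \<in> imaginary_units}"

definition slice :: "quat \<Rightarrow> quat set" where
  "slice I = {slice_point I x y | x y. True}"

definition slice_domain :: "quat set \<Rightarrow> bool" where
  "slice_domain \<Omega> \<longleftrightarrow>
     \<Omega> \<noteq> {} \<and> open \<Omega> \<and> connected \<Omega> \<and> \<Omega> \<inter> \<real> \<noteq> {} \<and>
     (\<forall>I\<in>imaginary_units.
        \<Omega> \<inter> slice I \<noteq> {} \<and> openin (top_of_set (slice I)) (\<Omega> \<inter> slice I) \<and>
        connected (\<Omega> \<inter> slice I))"

text \<open>
  The functions \<open>fx\<close> and \<open>fy\<close> are the partial derivatives of \<open>f\<^sub>I(x + yI)\<close>. Where \<open>\<Omega>\<close> is open,
  they depend only on the values of \<open>f\<close> on \<open>\<Omega>\<close>.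
\<close>

definition slice_regular_on :: "quat set \<Rightarrow> (quat \<Rightarrow> quat) \<Rightarrow> bool" where
  "slice_regular_on \<Omega> f \<longleftrightarrow>
     (\<forall>I\<in>imaginary_units.
        let U = {(x, y). slice_point I x y \<in> \<Omega>} in
        \<exists>fx fy. continuous_on U fx \<and> continuous_on U fy \<and>
          (\<forall>(x, y)\<in>U.
             ((\<lambda>t. f (slice_point I t y)) has_vector_derivative fx (x, y)) (at x) \<and>
             ((\<lambda>t. f (slice_point I x t)) has_vector_derivative fy (x, y)) (at y) \<and>
             (1/2) *\<^sub>R (fx (x, y) + I * fy (x, y)) = 0))"

definition zero_set :: "quat set \<Rightarrow> (quat \<Rightarrow> quat) \<Rightarrow> quat set" where
  "zero_set \<Omega> f = {q \<in> \<Omega>. f q = 0}"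

end

theory Submission
  imports Defs "HOL-Complex_Analysis.Conformal_Mappings"
begin

text \<open>
  Let \<open>C\<close> be a component of \<open>S \<inter> \<Omega>\<close>, where \<open>S\<close> is the sphere \<open>two_sphere x y\<close>, and let \<open>p\<close> be a
  point of \<open>C\<close> that is a limit of zeros of \<open>f\<close> outside \<open>C\<close>. The key is a representation formula
  near \<open>p\<close> and up to the real axis. By compactness of a path that joins \<open>p\<close> to the real axis
  within a slice, there are a connected open set \<open>D\<close> of complex numbers that meets \<open>\<real>\<close> and a set \<open>V\<close>
  of imaginary units such that \<open>x + yI \<in> \<Omega>\<close> for \<open>x + \<i>y \<in> D\<close> and \<open>I \<in> V\<close>, and these points cover
  a neighbourhood of \<open>p\<close> (\<open>slice_domain_local_product\<close>). The restrictions of \<open>f\<close> to two slices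
  \<open>J \<noteq> K\<close> in \<open>V\<close> determine functions \<open>A\<close>, \<open>B\<close> on \<open>D\<close> with \<open>f = A + J B\<close> on the one and \<open>f = A + K B\<close>
  on the other. They satisfy the Cauchy-Riemann equations \<open>A\<^sub>x = B\<^sub>y\<close>, \<open>A\<^sub>y = - B\<^sub>x\<close>, and \<open>B\<close> vanishes
  on the reals, since the slices meet there. Hence for every \<open>I \<in> V\<close> the functions \<open>f(x + yI)\<close> and
  \<open>A + I B\<close> are both regular and agree on \<open>D \<inter> \<real>\<close>, so they agree on \<open>D\<close>
  (\<open>slice_regular_local_representation\<close>).

  At a zero of \<open>A + I B\<close> we have \<open>\<bar>A\<bar> = \<bar>B\<bar>\<close> and \<open>A \<bullet> B = 0\<close>. So all zeros of \<open>f\<close> near \<open>p\<close>, whatever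
  their slice, give zeros of the single holomorphic function \<open>N = \<bar>A\<bar>\<^sup>2 - \<bar>B\<bar>\<^sup>2 + 2 \<i> (A \<bullet> B)\<close> on \<open>D\<close>.
  The points of the sphere \<open>S\<close> close to \<open>p\<close> all lie in \<open>C\<close> (\<open>component_two_sphere_nhd\<close>), so the
  given zeros lie off \<open>S\<close> and their images in \<open>D\<close> accumulate at the image of \<open>p\<close> without being equal
  to it. Therefore \<open>N = 0\<close> on \<open>D\<close>. On \<open>D \<inter> \<real>\<close>, where \<open>B = 0\<close>, this says \<open>A = 0\<close>, so \<open>f = 0\<close> there,
  and the identity principle on each slice gives \<open>f = 0\<close> on \<open>\<Omega>\<close>.
\<close>

section \<open>Partial derivatives and the Cauchy-Riemann equation\<close>

text \<open>
  \<open>gx\<close> and \<open>gy\<close> are continuous on \<open>D\<close> and are there the partial derivatives of \<open>g(x + \<i>y)\<close>. The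
  derivatives are two-sided and taken without reference to \<open>D\<close>, which makes no difference for
  open \<open>D\<close>.
\<close>
definition has_partials ::
    "complex set \<Rightarrow> (complex \<Rightarrow> 'b::real_normed_vector) \<Rightarrow> (complex \<Rightarrow> 'b) \<Rightarrow> (complex \<Rightarrow> 'b) \<Rightarrow> bool"
  where
  "has_partials D g gx gy \<longleftrightarrow>
     continuous_on D gx \<and> continuous_on D gy \<and>
     (\<forall>z\<in>D. ((\<lambda>t. g (Complex t (Im z))) has_vector_derivative gx z) (at (Re z)) \<and>
            ((\<lambda>t. g (Complex (Re z) t)) has_vector_derivative gy z) (at (Im z)))"

lemma has_partials_subset:
  "has_partials D g gx gy \<Longrightarrow> D' \<subseteq> D \<Longrightarrow> has_partials D' g gx gy"
  by (auto simp: has_partials_def intro: continuous_on_subset)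

lemma has_partials_add:
  "has_partials D g gx gy \<Longrightarrow> has_partials D h hx hy \<Longrightarrow>
     has_partials D (\<lambda>z. g z + h z) (\<lambda>z. gx z + hx z) (\<lambda>z. gy z + hy z)"
  by (auto simp: has_partials_def intro!: continuous_intros has_vector_derivative_add)

lemma has_partials_diff:
  "has_partials D g gx gy \<Longrightarrow> has_partials D h hx hy \<Longrightarrow>
     has_partials D (\<lambda>z. g z - h z) (\<lambda>z. gx z - hx z) (\<lambda>z. gy z - hy z)"
  by (auto simp: has_partials_def intro!: continuous_intros has_vector_derivative_diff)

lemma has_partials_linear:
  assumes "bounded_linear \<phi>" "has_partials D g gx gy"
  shows "has_partials D (\<lambda>z. \<phi> (g z)) (\<lambda>z. \<phi> (gx z)) (\<lambda>z. \<phi> (gy z))"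
  using assms
  by (auto simp: has_partials_def intro: bounded_linear.continuous_on
      bounded_linear.has_vector_derivative)

lemma has_partials_cong:
  assumes "has_partials D g gx gy" "\<And>z. z \<in> D \<Longrightarrow> gx z = gx' z" "\<And>z. z \<in> D \<Longrightarrow> gy z = gy' z"
  shows "has_partials D g gx' gy'"
  using assms by (auto simp: has_partials_def cong: continuous_on_cong)

text \<open>
  Continuity of the partial derivatives gives total differentiability, by
  \<open>has_derivative_partialsI\<close>; the equation \<open>h\<^sub>y = \<i> h\<^sub>x\<close> then makes the total derivative complex linear.
\<close>

lemma holomorphic_on_Cauchy_Riemann:
  fixes h :: "complex \<Rightarrow> complex"
  assumes "open D" and h: "has_partials D h hx (\<lambda>z. \<i> * hx z)"
  shows "h holomorphic_on D"
proof -
  have "(h has_field_derivative hx z) (at z)" if "z \<in> D" for z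
  proof -
    have "open ((\<lambda>(x, y). Complex x y) -` D)"
      unfolding case_prod_unfold
      by (intro open_vimage \<open>open D\<close> continuous_intros)
    moreover have "(Re z, Im z) \<in> (\<lambda>(x, y). Complex x y) -` D"
      using that by simp
    ultimately obtain A B where AB: "open A" "open B" "Re z \<in> A" "Im z \<in> B"
      and sub: "A \<times> B \<subseteq> (\<lambda>(x, y). Complex x y) -` D"
      by (rule open_prod_elim) (metis mem_Sigma_iff)
    obtain e where e: "e > 0" "ball (Im z) e \<subseteq> B"
      using AB openE by blast
    define Y where "Y = ball (Im z) e"
    have Y: "open Y" "convex Y" "Im z \<in> Y" "A \<times> Y \<subseteq> (\<lambda>(x, y). Complex x y) -` D"
      using e sub by (auto simp: Y_def)
    have cont: "continuous (at (Re z, Im z) within A \<times> Y) (\<lambda>(x, y). blinfun_scaleR_left (\<i> * hx (Complex x y)))"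
    proof -
      have "continuous_on D hx"
        using h by (simp add: has_partials_def)
      then have "continuous_on (A \<times> Y) (\<lambda>p. hx (Complex (fst p) (snd p)))"
        by (rule continuous_on_compose2) (use Y(4) in \<open>auto intro!: continuous_intros\<close>)
      then have "continuous_on (A \<times> Y) (\<lambda>(x, y). blinfun_scaleR_left (\<i> * hx (Complex x y)))"
        unfolding case_prod_unfold by (intro continuous_intros)
      then show ?thesis
        using AB Y by (simp add: continuous_on_eq_continuous_within)
    qed
    have "((\<lambda>(x, y). h (Complex x y)) has_derivative
        (\<lambda>(tx, ty). tx *\<^sub>R hx z + blinfun_scaleR_left (\<i> * hx (Complex (Re z) (Im z))) ty))
        (at (Re z, Im z) within A \<times> Y)"
    proof (rule has_derivative_partialsI)
      show "((\<lambda>x. h (Complex x (Im z))) has_derivative (\<lambda>t. t *\<^sub>R hx z)) (at (Re z) within A)"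
        using h that by (auto simp: has_partials_def has_vector_derivative_def
            intro: has_derivative_at_withinI)
      show "((\<lambda>y. h (Complex x y)) has_derivative
          blinfun_scaleR_left (\<i> * hx (Complex x y))) (at y within Y)" if "x \<in> A" "y \<in> Y" for x y
      proof -
        have "Complex x y \<in> D"
          using that Y by auto
        then have "((\<lambda>t. h (Complex x t)) has_vector_derivative \<i> * hx (Complex x y)) (at y)"
          using h unfolding has_partials_def by fastforce
        then show ?thesis
          by (auto simp: has_vector_derivative_def blinfun_scaleR_left.rep_eq
              intro: has_derivative_at_withinI)
      qed
    qed (use cont Y in auto)
    then have "((\<lambda>(x, y). h (Complex x y)) has_derivative
        (\<lambda>(tx, ty). tx *\<^sub>R hx z + ty *\<^sub>R (\<i> * hx z))) (at (Re z, Im z))"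
      using AB Y by (simp add: at_within_open[of _ "A \<times> Y"] open_Times)
    moreover have "((\<lambda>w. (Re w, Im w)) has_derivative (\<lambda>t. (Re t, Im t))) (at z)"
      by (auto intro!: derivative_eq_intros)
    ultimately have "(h has_derivative (\<lambda>t. Re t *\<^sub>R hx z + Im t *\<^sub>R (\<i> * hx z))) (at z)"
      using has_derivative_compose[of "\<lambda>w. (Re w, Im w)" "\<lambda>t. (Re t, Im t)" z UNIV
          "\<lambda>(x, y). h (Complex x y)" "\<lambda>(tx, ty). tx *\<^sub>R hx z + ty *\<^sub>R (\<i> * hx z)"] by simp
    moreover have "(\<lambda>t. Re t *\<^sub>R hx z + Im t *\<^sub>R (\<i> * hx z)) = (*) (hx z)"
      by (auto simp: complex_eq_iff algebra_simps)
    ultimately show ?thesis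
      by (simp add: has_field_derivative_def)
  qed
  then show ?thesis
    using \<open>open D\<close> by (auto simp: holomorphic_on_open)
qed

section \<open>Regular functions on a slice\<close>

lemma imaginary_units_iff: "J \<in> imaginary_units \<longleftrightarrow> Re0 J = 0 \<and> norm J = 1"
proof
  assume "J \<in> imaginary_units"
  then have *: "J * J = -1"
    by (simp add: imaginary_units_def power2_eq_square)
  then have "norm J * norm J = 1"
    by (metis norm_minus_cancel norm_mult norm_one)
  then have n: "norm J = 1"
    by (metis abs_norm_cancel real_sqrt_abs2 real_sqrt_one)
  have "(norm J)\<^sup>2 = (Re0 J)\<^sup>2 + (Im1 J)\<^sup>2 + (Im2 J)\<^sup>2 + (Im3 J)\<^sup>2"
    by (simp add: norm_quat_def)
  then have "(Re0 J)\<^sup>2 + (Im1 J)\<^sup>2 + (Im2 J)\<^sup>2 + (Im3 J)\<^sup>2 = 1"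
    using n by simp
  moreover have "(Re0 J)\<^sup>2 - (Im1 J)\<^sup>2 - (Im2 J)\<^sup>2 - (Im3 J)\<^sup>2 = -1"
    using arg_cong[OF *, of Re0] by (simp add: power2_eq_square)
  ultimately have "(Re0 J)\<^sup>2 = 0"
    by linarith
  then show "Re0 J = 0 \<and> norm J = 1"
    using n by simp
next
  assume *: "Re0 J = 0 \<and> norm J = 1"
  then have "(Im1 J)\<^sup>2 + (Im2 J)\<^sup>2 + (Im3 J)\<^sup>2 = 1"
    by (auto simp: norm_quat_def)
  then show "J \<in> imaginary_units"
    using * by (simp add: imaginary_units_def quat_eq_iff power2_eq_square)
qed

lemma imaginary_unit_mult_self: "I \<in> imaginary_units \<Longrightarrow> I * (I * q) = - q"
  unfolding imaginary_units_def power2_eq_square mult.assoc[symmetric] by simp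

text \<open>
  A real linear functional \<open>q \<mapsto> q \<bullet> c\<close>, made complex linear for the complex structure on the
  quaternions that is given by left multiplication by \<open>I\<close>. Composition with these functionals turns
  regular functions on the slice of \<open>I\<close> into holomorphic ones.
\<close>

definition slice_functional :: "quat \<Rightarrow> quat \<Rightarrow> quat \<Rightarrow> complex" where
  "slice_functional I c q = of_real (q \<bullet> c) - \<i> * of_real ((I * q) \<bullet> c)"

lemma bounded_linear_slice_functional: "bounded_linear (slice_functional I c)"
  unfolding slice_functional_def
  by (intro bounded_linear_sub bounded_linear_const_mult
      bounded_linear_compose[OF bounded_linear_of_real]
      bounded_linear_compose[OF bounded_linear_inner_left] bounded_linear_mult_right)
    (auto intro: bounded_linear_ident bounded_linear_inner_left
      bounded_linear_compose[OF bounded_linear_inner_left bounded_linear_mult_right])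

lemma slice_functional_mult:
  "I \<in> imaginary_units \<Longrightarrow> slice_functional I c (I * q) = \<i> * slice_functional I c q"
  by (simp add: slice_functional_def imaginary_unit_mult_self algebra_simps)

text \<open>
  The regularity condition on the slice of \<open>I\<close>, for a function of the complex variable \<open>x + \<i>y\<close>
  that stands for \<open>x + yI\<close>.
\<close>

definition regular_on :: "quat \<Rightarrow> complex set \<Rightarrow> (complex \<Rightarrow> quat) \<Rightarrow> bool" where
  "regular_on I D g \<longleftrightarrow> (\<exists>gx gy. has_partials D g gx gy \<and> (\<forall>z\<in>D. gx z + I * gy z = 0))"

lemma regular_on_diff:
  assumes "regular_on I D g" "regular_on I D h"
  shows "regular_on I D (\<lambda>z. g z - h z)"
proof -
  obtain gx gy hx hy where "has_partials D g gx gy" "\<forall>z\<in>D. gx z + I * gy z = 0"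
    "has_partials D h hx hy" "\<forall>z\<in>D. hx z + I * hy z = 0"
    using assms unfolding regular_on_def by blast
  then have "has_partials D (\<lambda>z. g z - h z) (\<lambda>z. gx z - hx z) (\<lambda>z. gy z - hy z)"
    "\<forall>z\<in>D. (gx z - hx z) + I * (gy z - hy z) = 0"
    by (auto intro: has_partials_diff simp: right_diff_distrib
        add_diff_add[symmetric] simp del: diff_add_eq)
  then show ?thesis
    unfolding regular_on_def by blast
qed

lemma regular_on_subset: "regular_on I D g \<Longrightarrow> D' \<subseteq> D \<Longrightarrow> regular_on I D' g"
  unfolding regular_on_def by (meson has_partials_subset subsetD)

text \<open>The identity principle on a single slice.\<close>

lemma regular_on_identity:
  assumes I: "I \<in> imaginary_units" and D: "open D" "connected D" and g: "regular_on I D g"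
    and U: "U \<subseteq> D" "\<xi> \<in> D" "\<xi> islimpt U" "\<And>z. z \<in> U \<Longrightarrow> g z = 0" and "z \<in> D"
  shows "g z = 0"
proof -
  obtain gx gy where *: "has_partials D g gx gy" "\<And>z. z \<in> D \<Longrightarrow> gx z + I * gy z = 0"
    using g unfolding regular_on_def by blast
  have "slice_functional I c (g z) = 0" for c
  proof (rule analytic_continuation[OF _ D U(1-3) _ \<open>z \<in> D\<close>])
    interpret bounded_linear "slice_functional I c"
      by (rule bounded_linear_slice_functional)
    have gy: "gy z = I * gx z" if "z \<in> D" for z
    proof -
      have "I * (gx z + I * gy z) = 0"
        using *(2)[OF that] by simp
      then show ?thesis
        by (simp add: distrib_left imaginary_unit_mult_self[OF I])
    qed
    have "has_partials D (\<lambda>z. slice_functional I c (g z)) (\<lambda>z. slice_functional I c (gx z))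
        (\<lambda>z. \<i> * slice_functional I c (gx z))"
      by (rule has_partials_cong[OF has_partials_linear[OF bounded_linear_slice_functional *(1)]])
        (simp_all add: gy slice_functional_mult[OF I])
    then show "(\<lambda>z. slice_functional I c (g z)) holomorphic_on D"
      by (rule holomorphic_on_Cauchy_Riemann[OF D(1)])
    show "slice_functional I c (g z) = 0" if "z \<in> U" for z
      using U(4)[OF that] by simp
  qed
  from this[of "g z"] have "g z \<bullet> g z = 0"
    by (simp add: slice_functional_def complex_eq_iff)
  then show ?thesis by simp
qed

section \<open>Stem functions\<close>

text \<open>
  \<open>A\<close> and \<open>B\<close> have continuous partial derivatives with \<open>A\<^sub>x = B\<^sub>y\<close> and \<open>A\<^sub>y = - B\<^sub>x\<close>; that is,
  \<open>A + \<i> B\<close> is a holomorphic function with values in the complexified quaternions. No symmetry of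
  \<open>D\<close> about the real axis is required.
\<close>

definition stem_pair :: "complex set \<Rightarrow> (complex \<Rightarrow> quat) \<Rightarrow> (complex \<Rightarrow> quat) \<Rightarrow> bool" where
  "stem_pair D A B \<longleftrightarrow>
     (\<exists>ax bx. has_partials D A ax (\<lambda>z. - bx z) \<and> has_partials D B bx ax)"

lemma stem_pair_imp_regular_on:
  assumes "stem_pair D A B" "I \<in> imaginary_units"
  shows "regular_on I D (\<lambda>z. A z + I * B z)"
proof -
  obtain ax bx where *: "has_partials D A ax (\<lambda>z. - bx z)" "has_partials D B bx ax"
    using assms(1) unfolding stem_pair_def by blast
  have "has_partials D (\<lambda>z. A z + I * B z) (\<lambda>z. ax z + I * bx z) (\<lambda>z. - bx z + I * ax z)"
    by (intro has_partials_add * has_partials_linear[OF bounded_linear_mult_right *(2)])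
  moreover have "ax z + I * bx z + I * (- bx z + I * ax z) = 0" for z
    by (simp add: right_diff_distrib imaginary_unit_mult_self[OF assms(2)])
  ultimately show ?thesis
    unfolding regular_on_def by blast
qed

text \<open>
  Solving \<open>g = A + J B\<close> and \<open>h = A + K B\<close> gives \<open>B = (J - K)\<inverse> (g - h)\<close>. The two regularity equations
  become \<open>u + J v = 0\<close> and \<open>u + K v = 0\<close> with \<open>u = A\<^sub>x - B\<^sub>y\<close> and \<open>v = B\<^sub>x + A\<^sub>y\<close>, whence \<open>u = v = 0\<close>.
\<close>

lemma stem_pair_of_two_units:
  assumes units: "J \<in> imaginary_units" "K \<in> imaginary_units" "J \<noteq> K"
    and g: "regular_on J D g" and h: "regular_on K D h"
  obtains A B where "stem_pair D A B" "\<And>z. g z = A z + J * B z" "\<And>z. h z = A z + K * B z"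
proof -
  define M where "M = inverse (J - K)"
  have M: "J * (M * q) - K * (M * q) = q" for q
    using units(3) by (simp add: M_def left_diff_distrib[symmetric] mult.assoc[symmetric])
  define B where "B z = M * (g z - h z)" for z
  define A where "A z = g z - J * B z" for z
  obtain gx gy where g: "has_partials D g gx gy" "\<And>z. z \<in> D \<Longrightarrow> gx z + J * gy z = 0"
    using g unfolding regular_on_def by blast
  obtain hx hy where h: "has_partials D h hx hy" "\<And>z. z \<in> D \<Longrightarrow> hx z + K * hy z = 0"
    using h unfolding regular_on_def by blast
  define bx where "bx z = M * (gx z - hx z)" for z
  define "by'" where "by' z = M * (gy z - hy z)" for z
  have B: "has_partials D B bx by'"
    unfolding B_def bx_def by'_def
    by (intro has_partials_linear[OF bounded_linear_mult_right] has_partials_diff g h)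
  define ax where "ax z = gx z - J * bx z" for z
  define ay where "ay z = gy z - J * by' z" for z
  have A: "has_partials D A ax ay"
    unfolding A_def ax_def ay_def
    by (intro has_partials_linear[OF bounded_linear_mult_right] has_partials_diff g B)
  have CR: "ax z = by' z" "ay z = - bx z" if "z \<in> D" for z
  proof -
    have gx: "gx z = ax z + J * bx z" and gy: "gy z = ay z + J * by' z"
      by (simp_all add: ax_def ay_def)
    have "hx z = gx z - (J * bx z - K * bx z)" "hy z = gy z - (J * by' z - K * by' z)"
      using M by (simp_all add: bx_def by'_def)
    then have hx: "hx z = ax z + K * bx z" and hy: "hy z = ay z + K * by' z"
      by (simp_all add: gx gy)
    define u v where "u = ax z - by' z" and "v = bx z + ay z"
    have J: "u + J * v = 0"
      using g(2)[OF that] units(1)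
      by (simp add: gx gy u_def v_def algebra_simps imaginary_unit_mult_self)
    have K: "u + K * v = 0"
      using h(2)[OF that] units(2)
      by (simp add: hx hy u_def v_def algebra_simps imaginary_unit_mult_self)
    have "J * v = K * v"
      using J K by (metis add_left_cancel)
    then have "v = 0"
      using units(3) by simp
    moreover from this J have "u = 0" by simp
    ultimately show "ax z = by' z" "ay z = - bx z"
      by (simp_all add: u_def v_def add_eq_0_iff)
  qed
  show ?thesis
  proof
    have "has_partials D A ax (\<lambda>z. - bx z)"
      by (rule has_partials_cong[OF A]) (simp_all add: CR)
    moreover have "has_partials D B bx ax"
      by (rule has_partials_cong[OF B]) (simp_all add: CR)
    ultimately show "stem_pair D A B"
      unfolding stem_pair_def by blast
    show "g z = A z + J * B z" for z
      by (simp add: A_def)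
    have "g z = h z + (J * B z - K * B z)" for z
      using M by (simp add: B_def)
    then show "h z = A z + K * B z" for z
      by (simp add: A_def)
  qed
qed

text \<open>
  The sum of the squares of the four complex coordinates of \<open>A + \<i> B\<close>. It plays the part of the
  normal function (symmetrization) of \<open>f\<close>.
\<close>

definition stem_normal :: "(complex \<Rightarrow> quat) \<Rightarrow> (complex \<Rightarrow> quat) \<Rightarrow> complex \<Rightarrow> complex" where
  "stem_normal A B z = (\<Sum>c\<in>Basis. (of_real (A z \<bullet> c) + \<i> * of_real (B z \<bullet> c))\<^sup>2)"

lemma stem_normal_eq:
  "stem_normal A B z = of_real ((norm (A z))\<^sup>2 - (norm (B z))\<^sup>2) + 2 * \<i> * of_real (A z \<bullet> B z)"
proof -
  have "stem_normal A B z =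
      of_real (\<Sum>c\<in>Basis. (A z \<bullet> c) * (A z \<bullet> c)) - of_real (\<Sum>c\<in>Basis. (B z \<bullet> c) * (B z \<bullet> c)) +
      2 * \<i> * of_real (\<Sum>c\<in>Basis. (A z \<bullet> c) * (B z \<bullet> c))"
    by (simp add: stem_normal_def power2_sum power_mult_distrib power2_eq_square[of "of_real _"]
        sum.distrib sum_subtractf sum_distrib_left algebra_simps sum_negf)
  then show ?thesis
    by (simp add: euclidean_inner[symmetric] power2_norm_eq_inner)
qed

lemma stem_normal_holomorphic:
  assumes "open D" "stem_pair D A B"
  shows "stem_normal A B holomorphic_on D"
proof -
  obtain ax bx where *: "has_partials D A ax (\<lambda>z. - bx z)" "has_partials D B bx ax"
    using assms(2) unfolding stem_pair_def by blast
  have "(\<lambda>z. of_real (A z \<bullet> c) + \<i> * of_real (B z \<bullet> c)) holomorphic_on D" for c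
  proof (rule holomorphic_on_Cauchy_Riemann[OF assms(1)])
    have re: "bounded_linear (\<lambda>q. complex_of_real (q \<bullet> c))"
      by (rule bounded_linear_compose[OF bounded_linear_of_real bounded_linear_inner_left])
    have im: "bounded_linear (\<lambda>q. \<i> * complex_of_real (q \<bullet> c))"
      by (rule bounded_linear_const_mult[OF re])
    show "has_partials D (\<lambda>z. of_real (A z \<bullet> c) + \<i> * of_real (B z \<bullet> c))
        (\<lambda>z. of_real (ax z \<bullet> c) + \<i> * of_real (bx z \<bullet> c))
        (\<lambda>z. \<i> * (of_real (ax z \<bullet> c) + \<i> * of_real (bx z \<bullet> c)))"
      by (rule has_partials_cong[OF has_partials_add[OF
              has_partials_linear[OF re *(1)] has_partials_linear[OF im *(2)]]])
        (simp_all add: algebra_simps)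
  qed
  then show ?thesis
    unfolding stem_normal_def by (intro holomorphic_on_sum holomorphic_on_power)
qed

lemma stem_normal_eq_0:
  assumes "I \<in> imaginary_units" "A z + I * B z = 0"
  shows "stem_normal A B z = 0"
proof -
  have A: "A z = - (I * B z)"
    using assms(2) by (simp add: eq_neg_iff_add_eq_0)
  have I: "Re0 I = 0" "norm I = 1"
    using assms(1) by (auto simp: imaginary_units_iff)
  have "(I * B z) \<bullet> B z = 0"
    by (simp add: inner_quat_def I algebra_simps)
  then show ?thesis
    by (simp add: stem_normal_eq A norm_mult I)
qed

section \<open>Slices, spheres and the half-plane\<close>

lemma quat_of_real_simps [simp]:
  "Re0 (of_real r) = r" "Im1 (of_real r) = 0" "Im2 (of_real r) = 0" "Im3 (of_real r) = 0"
  by (simp_all add: of_real_def)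

lemma continuous_on_Re0 [continuous_intros]:
  assumes "continuous_on A g"
  shows "continuous_on A (\<lambda>x. Re0 (g x))"
proof -
  have "continuous_on A (\<lambda>x. g x \<bullet> 1)"
    by (intro continuous_intros assms)
  then show ?thesis by (simp add: inner_quat_def)
qed

text \<open>The parametrization \<open>x + \<i>y \<mapsto> x + yI\<close> of the slice of \<open>I\<close> by the complex plane.\<close>

definition slice_embedding :: "quat \<Rightarrow> complex \<Rightarrow> quat" where
  "slice_embedding I z = slice_point I (Re z) (Im z)"

lemma slice_embedding_of_real [simp]: "slice_embedding I (of_real r) = of_real r"
  by (simp add: slice_embedding_def slice_point_def)

lemma slice_embedding_diff:
  "slice_embedding I z - slice_embedding I w = slice_embedding I (z - w)"
  by (simp add: slice_embedding_def slice_point_def algebra_simps)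

lemma continuous_on_slice_embedding [continuous_intros]:
  "continuous_on A g \<Longrightarrow> continuous_on A (\<lambda>x. slice_embedding I (g x))"
  unfolding slice_embedding_def slice_point_def by (intro continuous_intros)

lemma norm_slice_embedding:
  assumes "I \<in> imaginary_units"
  shows "norm (slice_embedding I z) = cmod z"
proof -
  have I: "Re0 I = 0" "(Im1 I)\<^sup>2 + (Im2 I)\<^sup>2 + (Im3 I)\<^sup>2 = 1"
    using assms by (auto simp: imaginary_units_iff norm_quat_def)
  have "(Re z)\<^sup>2 + (Im z * Im1 I)\<^sup>2 + (Im z * Im2 I)\<^sup>2 + (Im z * Im3 I)\<^sup>2 =
      (Re z)\<^sup>2 + (Im z)\<^sup>2 * ((Im1 I)\<^sup>2 + (Im2 I)\<^sup>2 + (Im3 I)\<^sup>2)"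
    by (simp add: algebra_simps power_mult_distrib)
  then show ?thesis
    by (simp add: slice_embedding_def slice_point_def norm_quat_def cmod_def I)
qed

text \<open>The component of \<open>q\<close> orthogonal to the real axis.\<close>

definition vector_part :: "quat \<Rightarrow> quat" where
  "vector_part q = q - of_real (Re0 q)"

text \<open>
  The point \<open>x + \<i>y\<close>, with \<open>y \<ge> 0\<close>, such that \<open>q\<close> lies on the sphere of the points \<open>x + yJ\<close>,
  \<open>J\<^sup>2 = - 1\<close>. It is continuous in \<open>q\<close>, also at the reals.
\<close>

definition half_plane_point :: "quat \<Rightarrow> complex" where
  "half_plane_point q = Complex (Re0 q) (norm (vector_part q))"

lemma continuous_on_vector_part [continuous_intros]:
  "continuous_on A g \<Longrightarrow> continuous_on A (\<lambda>x. vector_part (g x))"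
  unfolding vector_part_def by (intro continuous_intros)

lemma continuous_on_half_plane_point [continuous_intros]:
  "continuous_on A g \<Longrightarrow> continuous_on A (\<lambda>x. half_plane_point (g x))"
  unfolding half_plane_point_def by (intro continuous_intros)

lemma half_plane_point_of_real [simp]: "half_plane_point (of_real r) = of_real r"
  by (simp add: half_plane_point_def vector_part_def complex_eq_iff)

lemma sgn_imaginary_unit: "Re0 v = 0 \<Longrightarrow> v \<noteq> 0 \<Longrightarrow> sgn v \<in> imaginary_units"
  by (simp add: imaginary_units_iff norm_sgn) (simp add: sgn_quat_def)

lemma Re0_vector_part [simp]: "Re0 (vector_part q) = 0"
  by (simp add: vector_part_def)

lemma slice_embedding_sgn_vector_part:
  assumes "vector_part q \<noteq> 0"
  shows "slice_embedding (sgn (vector_part q)) (half_plane_point q) = q"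
  using assms
  by (simp add: slice_embedding_def slice_point_def half_plane_point_def sgn_quat_def
      scaleR_conv_of_real mult.assoc[symmetric] flip: of_real_mult)
    (simp add: vector_part_def)

lemma imaginary_unit_i: "Quat 0 1 0 0 \<in> imaginary_units"
  and imaginary_unit_j: "Quat 0 0 1 0 \<in> imaginary_units"
  by (simp_all add: imaginary_units_iff norm_quat_def)

lemma ex_slice_embedding: "\<exists>I\<in>imaginary_units. slice_embedding I (half_plane_point q) = q"
proof (cases "vector_part q = 0")
  case True
  then have "q = of_real (Re0 q)"
    by (simp add: vector_part_def)
  then show ?thesis
    by (metis imaginary_unit_i half_plane_point_of_real slice_embedding_of_real)
next
  case False
  then show ?thesis
    by (intro bexI[of _ "sgn (vector_part q)"] slice_embedding_sgn_vector_part sgn_imaginary_unit)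
      simp_all
qed

lemma two_sphere_iff: "q \<in> two_sphere x y \<longleftrightarrow> half_plane_point q = Complex x \<bar>y\<bar>"
proof
  assume "q \<in> two_sphere x y"
  then obtain J where J: "J \<in> imaginary_units" "q = slice_point J x y"
    by (auto simp: two_sphere_def)
  then have "Re0 q = x"
    by (simp add: slice_point_def imaginary_units_iff)
  moreover from this J have "norm (vector_part q) = \<bar>y\<bar>"
    by (simp add: vector_part_def slice_point_def imaginary_units_iff norm_mult)
  ultimately show "half_plane_point q = Complex x \<bar>y\<bar>"
    by (simp add: half_plane_point_def)
next
  assume q: "half_plane_point q = Complex x \<bar>y\<bar>"
  obtain I where I: "I \<in> imaginary_units" "slice_embedding I (half_plane_point q) = q"
    using ex_slice_embedding by blast
  then have "q = slice_point I x \<bar>y\<bar>"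
    by (simp add: q slice_embedding_def)
  then show "q \<in> two_sphere x y"
  proof (cases "y \<ge> 0")
    case False
    moreover have "- I \<in> imaginary_units"
      using I by (simp add: imaginary_units_iff)
    moreover have "slice_point I x (- y) = slice_point (- I) x y"
      by (simp add: slice_point_def)
    ultimately show ?thesis
      using \<open>q = _\<close> by (auto simp: two_sphere_def)
  qed (use I in \<open>auto simp: two_sphere_def\<close>)
qed

text \<open>
  Radial projection to the sphere of radius \<open>r\<close> at most doubles the distance to a point \<open>v\<close> of that
  sphere.
\<close>

lemma norm_sgn_diff_le:
  fixes u v :: "'a::real_normed_vector"
  assumes "norm v = r" "u \<noteq> 0"
  shows "norm (r *\<^sub>R sgn u - v) \<le> 2 * norm (u - v)"
proof -
  have "norm (r *\<^sub>R sgn u - u) = \<bar>r - norm u\<bar>"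
  proof -
    have "u = norm u *\<^sub>R sgn u"
      using assms(2) by (simp add: sgn_div_norm)
    then have "r *\<^sub>R sgn u - u = (r - norm u) *\<^sub>R sgn u"
      by (metis scaleR_left_diff_distrib)
    then show ?thesis
      using assms(2) by (simp add: norm_sgn)
  qed
  also have "\<dots> \<le> norm (u - v)"
    using norm_triangle_ineq3[of u v] assms(1) by (simp add: abs_minus_commute)
  finally show ?thesis
    using norm_triangle_ineq[of "r *\<^sub>R sgn u - u" "u - v"] by simp
qed

lemma imaginary_unit_not_isolated:
  assumes J: "J \<in> imaginary_units" and "e > 0"
  obtains K where "K \<in> imaginary_units" "K \<noteq> J" "norm (K - J) < e"
proof -
  obtain L where L: "L \<in> imaginary_units" "L \<noteq> J" "L \<noteq> - J"
  proof (cases "Quat 0 1 0 0 = J \<or> Quat 0 1 0 0 = - J")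
    case True
    then have "Quat 0 0 1 0 \<noteq> J" "Quat 0 0 1 0 \<noteq> - J"
      by (auto simp: quat_eq_iff)
    then show ?thesis using that imaginary_unit_j by blast
  next
    case False
    then show ?thesis using that imaginary_unit_i by blast
  qed
  define t where "t = min (1/2) (e/4)"
  have t: "0 < t" "t < 1" "2 * t < e"
    using \<open>e > 0\<close> by (auto simp: t_def min_def)
  define u where "u = J + t *\<^sub>R L"
  have norms: "norm J = 1" "norm L = 1" "Re0 u = 0"
    using J L by (auto simp: imaginary_units_iff u_def)
  have "norm (t *\<^sub>R L) < norm J"
    using norms t by simp
  then have u0: "u \<noteq> 0"
    unfolding u_def by (metis add_eq_0_iff less_irrefl norm_minus_cancel)
  show ?thesis
  proof
    show "sgn u \<in> imaginary_units"
      by (rule sgn_imaginary_unit[OF norms(3) u0])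
    have "norm (sgn u - J) \<le> 2 * norm (u - J)"
      using norm_sgn_diff_le[of J 1 u] norms u0 by simp
    then show "norm (sgn u - J) < e"
      using t norms by (simp add: u_def)
    show "sgn u \<noteq> J"
    proof
      assume "sgn u = J"
      then have "norm u *\<^sub>R J = u"
        using u0 by (metis norm_eq_zero scaleR_one sgn_div_norm scaleR_scaleR right_inverse)
      then have L': "t *\<^sub>R L = (norm u - 1) *\<^sub>R J"
        by (simp add: u_def scaleR_left_diff_distrib)
      then have "norm (t *\<^sub>R L) = norm ((norm u - 1) *\<^sub>R J)"
        by simp
      then have "t = \<bar>norm u - 1\<bar>"
        using norms t by simp
      then have "norm u - 1 = t \<or> norm u - 1 = - t"
        by linarith
      then have "t *\<^sub>R L = t *\<^sub>R J \<or> t *\<^sub>R L = t *\<^sub>R (- J)"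
        using L' by auto
      then show False
        using L t by (simp del: scaleR_minus_right)
    qed
  qed
qed

text \<open>
  The two-sphere is locally connected: a nearby point \<open>q\<close> of the sphere is joined to \<open>p\<close> by the
  radial projection of a segment, and this arc stays in a small ball around \<open>p\<close>. If the sphere is
  a single real point, there is nothing to show.
\<close>

lemma component_two_sphere_nhd:
  assumes "open \<Omega>" and C: "C \<in> components (two_sphere x y \<inter> \<Omega>)" and "p \<in> C"
  shows "\<forall>\<^sub>F q in nhds p. q \<in> two_sphere x y \<longrightarrow> q \<in> C"
proof -
  have pS: "p \<in> two_sphere x y \<inter> \<Omega>"
    using C \<open>p \<in> C\<close> in_components_subset by blast
  then obtain e where e: "e > 0" "ball p e \<subseteq> \<Omega>"
    using \<open>open \<Omega>\<close> by (meson IntD2 openE)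
  define v where "v = vector_part p"
  define r where "r = \<bar>y\<bar>"
  have p: "p = of_real x + v" and v: "norm v = r" "Re0 v = 0"
    using pS by (auto simp: two_sphere_iff half_plane_point_def v_def vector_part_def r_def)
  \<comment> \<open>The bound \<open>r\<close> keeps the segment away from \<open>0\<close>, and \<open>e/2\<close> keeps its projection inside \<open>\<Omega>\<close>.\<close>
  define d where "d = (if r = 0 then 1 else min r (e/2))"
  have d: "d > 0"
    using e by (auto simp: d_def r_def)
  have "q \<in> C" if "dist q p < d" and q: "q \<in> two_sphere x y" for q
  proof (cases "r = 0")
    case True
    then have "q = p"
      using q v by (auto simp: two_sphere_iff half_plane_point_def vector_part_def p r_def)
    then show ?thesis using \<open>p \<in> C\<close> by simp
  next
    case False
    define w where "w = vector_part q"
    have q': "q = of_real x + w" and w: "norm w = r" "Re0 w = 0"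
      using q by (auto simp: two_sphere_iff half_plane_point_def w_def vector_part_def r_def)
    have wv: "norm (w - v) < r" "2 * norm (w - v) < e"
      using that(1) False by (auto simp: d_def dist_norm q' p split: if_splits)
    define T where "T = (\<lambda>u. of_real x + r *\<^sub>R sgn u) ` closed_segment v w"
    have seg: "norm (u - v) \<le> norm (w - v)" "u \<noteq> 0" "Re0 u = 0" if "u \<in> closed_segment v w" for u
    proof -
      obtain t where t: "0 \<le> t" "t \<le> 1" "u = (1 - t) *\<^sub>R v + t *\<^sub>R w"
        using \<open>u \<in> _\<close> by (auto simp: in_segment)
      show "norm (u - v) \<le> norm (w - v)"
        using segment_bound1[OF that] by (simp add: norm_minus_commute)
      then show "u \<noteq> 0"
        using wv v by auto
      show "Re0 u = 0"
        using v w t by simp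
    qed
    have "connected T"
      unfolding T_def
      by (intro connected_continuous_image connected_segment)
        (auto intro!: continuous_intros dest: seg(2))
    moreover have "T \<subseteq> two_sphere x y \<inter> \<Omega>"
    proof (rule subsetI)
      fix s assume "s \<in> T"
      then obtain u where u: "u \<in> closed_segment v w" "s = of_real x + r *\<^sub>R sgn u"
        by (auto simp: T_def)
      have "norm (r *\<^sub>R sgn u - v) < e"
        using norm_sgn_diff_le[OF v(1) seg(2)[OF u(1)]] seg(1)[OF u(1)] wv(2) by linarith
      then have "s \<in> \<Omega>"
        using e(2) by (intro subsetD[OF e(2)]) (simp add: dist_norm u p norm_minus_commute)
      moreover have "s \<in> two_sphere x y"
        using seg[OF u(1)] by (simp add: two_sphere_iff half_plane_point_def vector_part_def u
            norm_sgn r_def sgn_quat_def)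
      ultimately show "s \<in> two_sphere x y \<inter> \<Omega>" by blast
    qed
    moreover have "p \<in> T"
      unfolding T_def p using v False by (intro image_eqI[of _ _ v]) (auto simp: sgn_div_norm)
    moreover have "q \<in> T"
      unfolding T_def q' using w False by (intro image_eqI[of _ _ w]) (auto simp: sgn_div_norm)
    ultimately show ?thesis
      using components_maximal[OF C] \<open>p \<in> C\<close> by blast
  qed
  then show ?thesis
    unfolding eventually_nhds_metric using d by blast
qed

section \<open>The local representation formula\<close>

text \<open>The part of \<open>\<Omega>\<close> in the slice of \<open>I\<close>, as a set of complex numbers.\<close>

definition slice_trace :: "quat set \<Rightarrow> quat \<Rightarrow> complex set" where
  "slice_trace \<Omega> I = {z. slice_embedding I z \<in> \<Omega>}"

lemma slice_trace_of_real: "of_real r \<in> slice_trace \<Omega> I \<longleftrightarrow> of_real r \<in> \<Omega>"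
  by (simp add: slice_trace_def)

lemma open_slice_trace: "open \<Omega> \<Longrightarrow> open (slice_trace \<Omega> I)"
  using open_vimage[of \<Omega> "slice_embedding I"]
  by (simp add: slice_trace_def vimage_def continuous_on_slice_embedding)

lemma connected_slice_trace:
  assumes I: "I \<in> imaginary_units" and "connected (\<Omega> \<inter> slice I)"
  shows "connected (slice_trace \<Omega> I)"
proof -
  \<comment> \<open>The parametrization of the slice has a continuous inverse.\<close>
  have inv: "Complex (Re0 (slice_embedding I z)) (slice_embedding I z \<bullet> I) = z" for z
  proof -
    have "Re0 I = 0" "I \<bullet> I = 1" "1 \<bullet> I = 0"
      using I by (auto simp: imaginary_units_iff norm_eq_1 inner_quat_def)
    moreover have "slice_embedding I z = Re z *\<^sub>R 1 + Im z *\<^sub>R I"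
      by (simp add: slice_embedding_def slice_point_def scaleR_conv_of_real)
    ultimately show ?thesis
      by (simp add: inner_add_left complex_eq_iff)
  qed
  have "slice_trace \<Omega> I = (\<lambda>q. Complex (Re0 q) (q \<bullet> I)) ` (\<Omega> \<inter> slice I)" (is "_ = ?h ` _")
  proof (intro equalityI subsetI)
    fix z assume "z \<in> slice_trace \<Omega> I"
    then have "slice_embedding I z \<in> \<Omega> \<inter> slice I"
      by (auto simp: slice_trace_def slice_def slice_embedding_def)
    then show "z \<in> ?h ` (\<Omega> \<inter> slice I)"
      using image_eqI[of z ?h "slice_embedding I z"] inv[of z] by simp
  next
    fix z assume "z \<in> ?h ` (\<Omega> \<inter> slice I)"
    then obtain x y where "z = ?h (slice_point I x y)" "slice_point I x y \<in> \<Omega>"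
      by (auto simp: slice_def)
    then show "z \<in> slice_trace \<Omega> I"
      using inv[of "Complex x y"] by (simp add: slice_trace_def slice_embedding_def)
  qed
  moreover have "connected (?h ` (\<Omega> \<inter> slice I))"
    by (intro connected_continuous_image assms continuous_intros)
  ultimately show ?thesis by simp
qed

lemma slice_regular_on_imp_regular_on:
  assumes "slice_regular_on \<Omega> f" "I \<in> imaginary_units"
  shows "regular_on I (slice_trace \<Omega> I) (\<lambda>z. f (slice_embedding I z))"
proof -
  define U where "U = {(x, y). slice_point I x y \<in> \<Omega>}"
  obtain fx fy where f: "continuous_on U fx" "continuous_on U fy" and
    d: "\<And>x y. (x, y) \<in> U \<Longrightarrow>
      ((\<lambda>t. f (slice_point I t y)) has_vector_derivative fx (x, y)) (at x) \<and>
      ((\<lambda>t. f (slice_point I x t)) has_vector_derivative fy (x, y)) (at y) \<and>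
      (1/2) *\<^sub>R (fx (x, y) + I * fy (x, y)) = 0"
    using assms unfolding slice_regular_on_def Let_def U_def by fast
  have U: "(Re z, Im z) \<in> U" if "z \<in> slice_trace \<Omega> I" for z
    using that by (simp add: U_def slice_trace_def slice_embedding_def)
  have "has_partials (slice_trace \<Omega> I) (\<lambda>z. f (slice_embedding I z))
      (\<lambda>z. fx (Re z, Im z)) (\<lambda>z. fy (Re z, Im z))"
    unfolding has_partials_def
  proof (intro conjI ballI)
    show "continuous_on (slice_trace \<Omega> I) (\<lambda>z. fx (Re z, Im z))"
      by (rule continuous_on_compose2[OF f(1)]) (use U in \<open>auto intro!: continuous_intros\<close>)
    show "continuous_on (slice_trace \<Omega> I) (\<lambda>z. fy (Re z, Im z))"
      by (rule continuous_on_compose2[OF f(2)]) (use U in \<open>auto intro!: continuous_intros\<close>)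
  qed (use d U in \<open>simp_all add: slice_embedding_def\<close>)
  moreover have "fx (Re z, Im z) + I * fy (Re z, Im z) = 0" if "z \<in> slice_trace \<Omega> I" for z
    using d[OF U[OF that]] by simp
  ultimately show ?thesis
    unfolding regular_on_def by blast
qed

lemma islimpt_Reals_Int_open:
  assumes "open D" "of_real r \<in> D"
  shows "(of_real r :: complex) islimpt (D \<inter> \<real>)"
proof (rule islimptI)
  fix T :: "complex set"
  assume T: "of_real r \<in> T" "open T"
  then have "open (T \<inter> D)" "of_real r \<in> T \<inter> D"
    using assms by auto
  then obtain e where e: "e > 0" "ball (of_real r) e \<subseteq> T \<inter> D"
    by (meson openE)
  have "complex_of_real (r + e / 2) \<in> ball (of_real r) e"
    using \<open>e > 0\<close> by (simp add: dist_norm flip: of_real_diff)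
  then show "\<exists>w\<in>D \<inter> \<real>. w \<in> T \<and> w \<noteq> of_real r"
    using e by (intro bexI[of _ "of_real (r + e / 2)"]) (auto simp del: of_real_add)
qed

lemma regular_on_eq_0_if_zero_on_Reals:
  assumes I: "I \<in> imaginary_units" and D: "open D" "connected D" "D \<inter> \<real> \<noteq> {}"
    and g: "regular_on I D g" and "\<And>z. z \<in> D \<inter> \<real> \<Longrightarrow> g z = 0" and "z \<in> D"
  shows "g z = 0"
proof -
  obtain r where r: "of_real r \<in> D"
    using D(3) by (auto simp: Reals_def)
  show ?thesis
    by (rule regular_on_identity[OF I D(1,2) g _ r islimpt_Reals_Int_open[OF D(1) r]])
      (use assms in auto)
qed

text \<open>
  The neighbourhood of \<open>p\<close> on which the representation formula is set up. For real \<open>p\<close> a ball around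
  \<open>p\<close> and all imaginary units serve. Otherwise \<open>D\<close> is a tube around a path from \<open>p\<close> to the real axis
  in the slice of \<open>p\<close>, and \<open>V\<close> consists of the units close to that of \<open>p\<close>.
\<close>

lemma slice_domain_local_product:
  assumes \<Omega>: "slice_domain \<Omega>" and "p \<in> \<Omega>"
  obtains D V J K where "open D" "connected D" "D \<inter> \<real> \<noteq> {}" "V \<subseteq> imaginary_units"
    "J \<in> V" "K \<in> V" "J \<noteq> K" "\<And>z I. z \<in> D \<Longrightarrow> I \<in> V \<Longrightarrow> slice_embedding I z \<in> \<Omega>"
    "\<forall>\<^sub>F q in nhds p. half_plane_point q \<in> D \<and> (\<exists>I\<in>V. slice_embedding I (half_plane_point q) = q)"
proof -
  have open_\<Omega>: "open \<Omega>"
    using \<Omega> by (simp add: slice_domain_def)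
  have ev_D: "\<forall>\<^sub>F q in nhds p. half_plane_point q \<in> D"
    if "open D" "half_plane_point p \<in> D" for D
  proof -
    have "open (half_plane_point -` D)"
      by (intro open_vimage that continuous_intros)
    then have "\<forall>\<^sub>F q in nhds p. q \<in> half_plane_point -` D"
      by (rule eventually_nhds_in_open) (use that in simp)
    then show ?thesis by simp
  qed
  show ?thesis
  proof (cases "vector_part p = 0")
    case True
    define r where "r = Re0 p"
    have p: "p = of_real r"
      using True by (simp add: r_def vector_part_def)
    obtain e where e: "e > 0" "ball p e \<subseteq> \<Omega>"
      using open_\<Omega> \<open>p \<in> \<Omega>\<close> by (meson openE)
    show ?thesis
    proof (rule that[of "ball (of_real r) e" imaginary_units "Quat 0 1 0 0" "Quat 0 0 1 0"])
      have "complex_of_real r \<in> ball (of_real r) e \<inter> \<real>"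
        using e by simp
      then show "ball (complex_of_real r) e \<inter> \<real> \<noteq> {}"
        by blast
      show "slice_embedding I z \<in> \<Omega>"
        if z: "z \<in> ball (of_real r) e" and I: "I \<in> imaginary_units" for z I
      proof -
        have "norm (slice_embedding I (of_real r - z)) < e"
          using z I by (simp add: norm_slice_embedding dist_norm)
        then have "dist p (slice_embedding I z) < e"
          by (simp add: dist_norm p flip: slice_embedding_diff)
        then show ?thesis using e by auto
      qed
      have "\<forall>\<^sub>F q in nhds p. half_plane_point q \<in> ball (of_real r) e"
        by (rule ev_D) (use e in \<open>simp_all add: p\<close>)
      then show "\<forall>\<^sub>F q in nhds p. half_plane_point q \<in> ball (of_real r) e \<and>
          (\<exists>I\<in>imaginary_units. slice_embedding I (half_plane_point q) = q)"
        by eventually_elim (use ex_slice_embedding in auto)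
    qed (auto simp: imaginary_unit_i imaginary_unit_j)
  next
    case False
    define J where "J = sgn (vector_part p)"
    have J: "J \<in> imaginary_units"
      unfolding J_def by (rule sgn_imaginary_unit) (simp_all add: False)
    have Jp: "slice_embedding J (half_plane_point p) = p"
      unfolding J_def by (rule slice_embedding_sgn_vector_part[OF False])
    obtain r where r: "of_real r \<in> \<Omega>"
      using \<Omega> by (auto simp: slice_domain_def Reals_def)
    have "path_connected (slice_trace \<Omega> J)"
      using \<Omega> J by (intro connected_open_path_connected open_slice_trace connected_slice_trace)
        (auto simp: slice_domain_def)
    moreover have "half_plane_point p \<in> slice_trace \<Omega> J" "of_real r \<in> slice_trace \<Omega> J"
      using r \<open>p \<in> \<Omega>\<close> Jp by (simp_all add: slice_trace_def)
    ultimately obtain \<gamma> where \<gamma>: "path \<gamma>" "path_image \<gamma> \<subseteq> slice_trace \<Omega> J"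
      "pathstart \<gamma> = half_plane_point p" "pathfinish \<gamma> = of_real r"
      unfolding path_connected_def by blast
    define P where "P = path_image \<gamma>"
    have P: "compact P" "connected P" "half_plane_point p \<in> P" "of_real r \<in> P"
      using \<gamma> pathstart_in_path_image[of \<gamma>] pathfinish_in_path_image[of \<gamma>]
      by (auto simp: P_def compact_path_image connected_path_image)
    have "compact (slice_embedding J ` P)"
      by (intro compact_continuous_image P continuous_intros)
    moreover have "slice_embedding J ` P \<subseteq> \<Omega>"
      using \<gamma>(2) by (auto simp: P_def slice_trace_def)
    ultimately obtain e where e: "e > 0" "(\<Union>q\<in>slice_embedding J ` P. ball q e) \<subseteq> \<Omega>"
      using compact_subset_open_imp_ball_epsilon_subset open_\<Omega> by metis
    obtain M where M: "M > 0" "\<And>w. w \<in> P \<Longrightarrow> cmod w \<le> M"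
      using compact_imp_bounded[OF P(1)] bounded_pos by metis
    define D where "D = {w + d | w d. w \<in> P \<and> d \<in> ball 0 (e / 2)}"
    \<comment> \<open>As \<open>\<bar>Im z\<bar> \<le> M + e\<close> on \<open>D\<close>, a change of the unit by less than \<open>\<eta>\<close> moves points by less than \<open>e/2\<close>.\<close>
    define \<eta> where "\<eta> = (e / 2) / (M + e)"
    define V where "V = {I\<in>imaginary_units. norm (I - J) < \<eta>}"
    have "\<eta> > 0"
      using e M by (simp add: \<eta>_def)
    have PD: "P \<subseteq> D"
    proof
      fix w assume "w \<in> P"
      then have "w + 0 \<in> D"
        unfolding D_def using e by (intro CollectI exI[of _ w] exI[of _ 0]) simp
      then show "w \<in> D" by simp
    qed
    obtain K where K: "K \<in> imaginary_units" "K \<noteq> J" "norm (K - J) < \<eta>"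
      using imaginary_unit_not_isolated[OF J \<open>\<eta> > 0\<close>] by blast
    show ?thesis
    proof (rule that[of D V J K])
      show "open D"
      proof -
        have "D = (\<Union>w\<in>P. \<Union>d\<in>ball 0 (e / 2). {w + d})"
          unfolding D_def by blast
        then show ?thesis
          using open_sums[of P "ball 0 (e / 2)"] by simp
      qed
      have "D = (\<lambda>(w, d). w + d) ` (P \<times> ball 0 (e / 2))"
        unfolding D_def by (auto simp del: mem_ball mem_ball_0)
      then show "connected D"
        unfolding case_prod_unfold using P
        by (auto intro!: connected_continuous_image connected_Times continuous_intros)
      show "D \<inter> \<real> \<noteq> {}"
        using P PD by (metis IntI Reals_of_real empty_iff subsetD)
      show "slice_embedding I z \<in> \<Omega>" if "z \<in> D" "I \<in> V" for z I
      proof -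
        obtain w d where z: "z = w + d" "w \<in> P" "cmod d < e / 2"
          using \<open>z \<in> D\<close> by (auto simp: D_def)
        have "\<bar>Im z\<bar> \<le> cmod z"
          by (rule abs_Im_le_cmod)
        also have "\<dots> \<le> M + e"
          using norm_triangle_ineq[of w d] M(2)[OF z(2)] z e by simp
        finally have "\<bar>Im z\<bar> * norm (I - J) \<le> (M + e) * norm (I - J)"
          by (rule mult_right_mono) simp
        also have "\<dots> < (M + e) * \<eta>"
          using that(2) M e by (intro mult_strict_left_mono) (auto simp: V_def)
        also have "\<dots> = e / 2"
        proof -
          have "M + e \<noteq> 0"
            using M e by linarith
          from nonzero_mult_div_cancel_left[OF this, of "e / 2"] show ?thesis
            by (simp only: \<eta>_def times_divide_eq_right)
        qed
        finally have 1: "norm (slice_embedding I z - slice_embedding J z) < e / 2"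
          by (simp add: slice_embedding_def slice_point_def norm_mult flip: right_diff_distrib)
        have 2: "norm (slice_embedding J z - slice_embedding J w) < e / 2"
          using z by (simp add: slice_embedding_diff norm_slice_embedding[OF J])
        have "dist (slice_embedding J w) (slice_embedding I z) < e"
          using norm_triangle_ineq[of "slice_embedding I z - slice_embedding J z"
              "slice_embedding J z - slice_embedding J w"] 1 2
          by (simp add: dist_norm norm_minus_commute)
        then show ?thesis
          using e(2) z(2) by (auto simp: subset_iff)
      qed
      have "\<forall>\<^sub>F q in nhds p. vector_part q \<noteq> 0 \<and> norm (sgn (vector_part q) - J) < \<eta>"
      proof -
        have lim: "(vector_part \<longlongrightarrow> vector_part p) (nhds p)"
          using continuous_on_vector_part[OF continuous_on_id, of UNIV]
          by (simp add: continuous_on_eq_continuous_at isCont_def tendsto_nhds_iff)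
        have "((\<lambda>q. sgn (vector_part q)) \<longlongrightarrow> J) (nhds p)"
          unfolding J_def by (intro tendsto_sgn lim False)
        then have "\<forall>\<^sub>F q in nhds p. dist (sgn (vector_part q)) J < \<eta>"
          using \<open>\<eta> > 0\<close> by (rule tendstoD)
        moreover have "\<forall>\<^sub>F q in nhds p. vector_part q \<noteq> 0"
          by (rule tendsto_imp_eventually_ne[OF lim False])
        ultimately show ?thesis
          by eventually_elim (simp add: dist_norm)
      qed
      moreover have "\<forall>\<^sub>F q in nhds p. half_plane_point q \<in> D"
        by (rule ev_D[OF \<open>open D\<close>]) (use P PD in auto)
      ultimately show "\<forall>\<^sub>F q in nhds p. half_plane_point q \<in> D \<and>
          (\<exists>I\<in>V. slice_embedding I (half_plane_point q) = q)"
      proof eventually_elim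
        case (elim q)
        then have "sgn (vector_part q) \<in> V"
          by (auto simp: V_def intro: sgn_imaginary_unit)
        then show ?case
          using elim slice_embedding_sgn_vector_part by blast
      qed
    qed (use J K \<open>\<eta> > 0\<close> in \<open>auto simp: V_def\<close>)
  qed
qed

text \<open>
  The coefficients \<open>A\<close>, \<open>B\<close> are computed from the slices of \<open>J\<close> and \<open>K\<close> only, but they serve all units
  in \<open>V\<close>: both sides are regular and agree on the real points of \<open>D\<close>.
\<close>

lemma slice_regular_local_representation:
  assumes f: "slice_regular_on \<Omega> f"
    and D: "open D" "connected D" "D \<inter> \<real> \<noteq> {}"
    and V: "V \<subseteq> imaginary_units" "J \<in> V" "K \<in> V" "J \<noteq> K"
    and sub: "\<And>z I. z \<in> D \<Longrightarrow> I \<in> V \<Longrightarrow> slice_embedding I z \<in> \<Omega>"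
  obtains A B where "stem_pair D A B" "\<And>z. z \<in> D \<inter> \<real> \<Longrightarrow> B z = 0"
    "\<And>z I. z \<in> D \<Longrightarrow> I \<in> V \<Longrightarrow> f (slice_embedding I z) = A z + I * B z"
proof -
  have reg: "regular_on I D (\<lambda>z. f (slice_embedding I z))" if "I \<in> V" for I
    using that V(1) sub
    by (intro regular_on_subset[OF slice_regular_on_imp_regular_on[OF f]]) (auto simp: slice_trace_def)
  obtain A B where AB: "stem_pair D A B"
    "\<And>z. f (slice_embedding J z) = A z + J * B z"
    "\<And>z. f (slice_embedding K z) = A z + K * B z"
    using stem_pair_of_two_units[OF _ _ V(4) reg[OF V(2)] reg[OF V(3)]] V by (metis subsetD)
  \<comment> \<open>At a real point the slices of \<open>J\<close> and \<open>K\<close> meet, so \<open>A + J B = A + K B\<close> there.\<close>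
  have B0: "B z = 0" if "z \<in> D \<inter> \<real>" for z
  proof -
    have "J * B z = K * B z"
      using that AB(2,3)[of z] by (auto simp: Reals_def)
    then show ?thesis using V(4) by simp
  qed
  have "f (slice_embedding I z) = A z + I * B z" if "z \<in> D" "I \<in> V" for z I
  proof -
    have I: "I \<in> imaginary_units"
      using that V by blast
    have "f (slice_embedding I z) - (A z + I * B z) = 0"
    proof (rule regular_on_eq_0_if_zero_on_Reals[OF I D _ _ that(1)])
      show "regular_on I D (\<lambda>z. f (slice_embedding I z) - (A z + I * B z))"
        by (intro regular_on_diff reg that stem_pair_imp_regular_on AB I)
      show "f (slice_embedding I w) - (A w + I * B w) = 0" if "w \<in> D \<inter> \<real>" for w
        using AB(2)[of w] B0[OF that] that by (auto simp: Reals_def)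
    qed
    then show ?thesis by simp
  qed
  with AB(1) B0 that show ?thesis by blast
qed

lemma slice_regular_eq_0_if_zero_on_Reals:
  assumes \<Omega>: "slice_domain \<Omega>" and f: "slice_regular_on \<Omega> f"
    and D: "open D" "D \<inter> \<real> \<noteq> {}"
    and zero: "\<And>r. complex_of_real r \<in> D \<Longrightarrow> of_real r \<in> \<Omega> \<and> f (of_real r) = 0"
    and "q \<in> \<Omega>"
  shows "f q = 0"
proof -
  obtain I where I: "I \<in> imaginary_units" "slice_embedding I (half_plane_point q) = q"
    using ex_slice_embedding by blast
  have T: "open (slice_trace \<Omega> I)" "connected (slice_trace \<Omega> I)"
    using \<Omega> I by (auto simp: slice_domain_def intro: open_slice_trace connected_slice_trace)
  obtain r where r: "of_real r \<in> D"
    using D(2) by (auto simp: Reals_def)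
  have "f (slice_embedding I (half_plane_point q)) = 0"
  proof (rule regular_on_identity[OF I(1) T slice_regular_on_imp_regular_on[OF f I(1)] _ _
        islimpt_Reals_Int_open[OF D(1) r]])
    show "D \<inter> \<real> \<subseteq> slice_trace \<Omega> I"
      using zero by (auto simp: Reals_def slice_trace_of_real)
    then show "of_real r \<in> slice_trace \<Omega> I"
      using r by auto
    show "f (slice_embedding I z) = 0" if "z \<in> D \<inter> \<real>" for z
      using zero that by (auto simp: Reals_def)
    show "half_plane_point q \<in> slice_trace \<Omega> I"
      using I \<open>q \<in> \<Omega>\<close> by (simp add: slice_trace_def)
  qed
  then show ?thesis by (simp add: I)
qed

section \<open>Accumulation of zeros\<close>

theorem theorem5p2:
  fixes \<Omega> :: "quat set" and f :: "quat \<Rightarrow> quat"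
  assumes "slice_domain \<Omega>"
    and "slice_regular_on \<Omega> f"
  shows "(\<forall>q\<in>\<Omega>. f q = 0) \<or>
    (\<forall>x y :: real. two_sphere x y \<inter> \<Omega> \<noteq> {} \<longrightarrow>
      (\<forall>C\<in>components (two_sphere x y \<inter> \<Omega>).
         \<not> (\<exists>p\<in>C. p islimpt (zero_set \<Omega> f - C))))"
proof -
  have "f q = 0"
    if C: "C \<in> components (two_sphere x y \<inter> \<Omega>)" and "p \<in> C"
      and lim: "p islimpt (zero_set \<Omega> f - C)" and "q \<in> \<Omega>" for x y C p q
  proof -
    have p: "p \<in> two_sphere x y" "p \<in> \<Omega>"
      using C \<open>p \<in> C\<close> in_components_subset by blast+
    obtain D V J K where D: "open D" "connected D" "D \<inter> \<real> \<noteq> {}"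
      and V: "V \<subseteq> imaginary_units" "J \<in> V" "K \<in> V" "J \<noteq> K"
      and sub: "\<And>z I. z \<in> D \<Longrightarrow> I \<in> V \<Longrightarrow> slice_embedding I z \<in> \<Omega>"
      and near: "\<forall>\<^sub>F q in nhds p. half_plane_point q \<in> D \<and>
        (\<exists>I\<in>V. slice_embedding I (half_plane_point q) = q)"
      using slice_domain_local_product[OF assms(1) p(2)] by blast
    obtain A B where AB: "stem_pair D A B" "\<And>z. z \<in> D \<inter> \<real> \<Longrightarrow> B z = 0"
      and rep: "\<And>z I. z \<in> D \<Longrightarrow> I \<in> V \<Longrightarrow> f (slice_embedding I z) = A z + I * B z"
      using slice_regular_local_representation[OF assms(2) D V sub] by blast
    define Z where "Z = {z\<in>D. stem_normal A B z = 0}"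
    \<comment> \<open>Zeros of \<open>f\<close> outside \<open>C\<close> and near \<open>p\<close> are off the sphere, so their half-plane points differ from that of \<open>p\<close>.\<close>
    have "half_plane_point p islimpt Z"
    proof (rule islimptI)
      fix T assume T: "half_plane_point p \<in> T" "open T"
      have "\<forall>\<^sub>F q in nhds p. q \<in> half_plane_point -` T"
        by (intro eventually_nhds_in_open open_vimage T continuous_intros) (use T in simp)
      with near component_two_sphere_nhd[OF _ C \<open>p \<in> C\<close>]
      have "\<forall>\<^sub>F q in nhds p. half_plane_point q \<in> T \<and> half_plane_point q \<in> D \<and>
          (\<exists>I\<in>V. slice_embedding I (half_plane_point q) = q) \<and> (q \<in> two_sphere x y \<longrightarrow> q \<in> C)"
        using assms(1) by (auto simp: slice_domain_def eventually_conj_iff)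
      then obtain S where S: "open S" "p \<in> S" and *: "\<And>q. q \<in> S \<Longrightarrow>
          half_plane_point q \<in> T \<and> half_plane_point q \<in> D \<and>
          (\<exists>I\<in>V. slice_embedding I (half_plane_point q) = q) \<and> (q \<in> two_sphere x y \<longrightarrow> q \<in> C)"
        unfolding eventually_nhds by metis
      obtain s where s: "s \<in> zero_set \<Omega> f - C" "s \<in> S"
        using lim S by (auto simp: islimpt_def)
      obtain I where I: "I \<in> V" "slice_embedding I (half_plane_point s) = s"
        using * s by blast
      have "A (half_plane_point s) + I * B (half_plane_point s) = 0"
        using rep[of "half_plane_point s" I] *[OF s(2)] I s(1) by (simp add: zero_set_def)
      then have "half_plane_point s \<in> Z"
        using I V(1) *[OF s(2)] by (auto simp: Z_def intro: stem_normal_eq_0)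
      moreover have "half_plane_point s \<noteq> half_plane_point p"
        using *[OF s(2)] s(1) p(1) by (auto simp: two_sphere_iff)
      ultimately show "\<exists>z\<in>Z. z \<in> T \<and> z \<noteq> half_plane_point p"
        using *[OF s(2)] by blast
    qed
    moreover have "half_plane_point p \<in> D"
      using near by (auto dest: eventually_nhds_x_imp_x)
    ultimately have N: "stem_normal A B z = 0" if "z \<in> D" for z
      by (intro analytic_continuation[OF stem_normal_holomorphic[OF D(1) AB(1)] D(1,2) _ _ _ _ that,
            of Z "half_plane_point p"]) (simp_all add: Z_def)
    show ?thesis
    proof (rule slice_regular_eq_0_if_zero_on_Reals[OF assms D(1,3) _ \<open>q \<in> \<Omega>\<close>])
      fix r assume r: "complex_of_real r \<in> D"
      then have B: "B (of_real r) = 0"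
        by (intro AB(2)) simp
      then have A: "A (of_real r) = 0"
        using N[OF r] by (simp add: stem_normal_eq)
      show "of_real r \<in> \<Omega> \<and> f (of_real r) = 0"
        using sub[OF r V(2)] rep[OF r V(2)] by (simp add: A B)
    qed
  qed
  then show ?thesis by blast
qed

end
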